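(* For all integers $k\ge1$ and $n\ge1$ there exist $0<\epsilon'=\epsilon'(n,k)<\epsilon''=\epsilon''(n,k)<1/2$ such that for all $\epsilon$ with $0<\epsilon<\epsilon'$ or $\epsilon''<\epsilon<1/2$, the unique best protocol up to $\pi_S$ for maximizing $\mathbf{P}[f_1(y^1)=\dots=f_k(y^k)]$ over $f_1,\dots,f_k\in\mathcal{B}_n$ is given by $f_1=\dots=f_k=f$, where $f(x)=x_1$ (i.e., $f$ is the majority function on the first bit alone).
   Context: Model: $x$ is uniform in $\{0,1\}^n$; $y^1,\dots,y^k \in \{0,1\}^n$ are random strings such that, given $x$, the events $\{y^i_j = x_j\}$ ($1\le i\le k$, $1\le j\le n$) are mutually independent, each of probability $1-\epsilon$. $\mathcal{B}_n$ is the set of balanced functions $f:\{0,1\}^n\to\{0,1\}$, i.e. $|f^{-1}(0)| = |f^{-1}(1)|$. A protocol is a tuple $(f_1,\dots,f_k)$ of functions in $\mathcal{B}_n$. For $S\subseteq[n]$ and a permutation $\pi$ of $[n]$, $\pi_S:\{0,1\}^n\to\{0,1\}^n$ is defined by $\pi_S(x)_i = x_{\pi(i)}$ if $i\in S$ and $\pi_S(x)_i = 1-x_{\pi(i)}$ if $i\notin S$. For fixed $k,n,\epsilon$, $(f_1,\dots,f_k)$ is "the unique best protocol up to $\pi_S$" if the set of all maximizing protocols is exactly $\{(f_1\circ\pi_S,\dots,f_k\circ\pi_S): S\subseteq[n],\ \pi \text{ a permutation of } [n]\}$.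
   Formalization: The case k = 1 with n ≥ 2 is excluded, since there the agreement probability is always 1, every balanced function (e.g. x_1 XOR x_2) is a maximizer, and uniqueness up to π_S fails; all k ≥ 2 and k = n = 1 are covered. *)

theory Defs
  imports "HOL-Probability.Probability"
begin

text \<open>
  Bits are booleans. Strings, functions on the cube and protocols are extensional functions, so
  that equality of these objects is equality of the mathematical functions on their domains.
\<close>

definition cube :: "nat \<Rightarrow> (nat \<Rightarrow> bool) set" where
  "cube n = {1..n} \<rightarrow>\<^sub>E UNIV"

definition noisy_copy :: "nat \<Rightarrow> real \<Rightarrow> (nat \<Rightarrow> bool) \<Rightarrow> (nat \<Rightarrow> bool) pmf" where
  "noisy_copy n \<epsilon> x =
     Pi_pmf {1..n} undefined
       (\<lambda>j. map_pmf (\<lambda>correct. if correct then x j else \<not> x j) (bernoulli_pmf (1 - \<epsilon>)))"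

text \<open>The joint distribution of \<open>x\<close> and \<open>(y\<^sup>1, \<dots>, y\<^sup>k)\<close>.\<close>

definition source_model ::
    "nat \<Rightarrow> nat \<Rightarrow> real \<Rightarrow> ((nat \<Rightarrow> bool) \<times> (nat \<Rightarrow> nat \<Rightarrow> bool)) pmf" where
  "source_model k n \<epsilon> =
     bind_pmf (pmf_of_set (cube n)) (\<lambda>x.
       map_pmf (\<lambda>y. (x, y)) (Pi_pmf {1..k} undefined (\<lambda>i. noisy_copy n \<epsilon> x)))"

definition balanced :: "nat \<Rightarrow> ((nat \<Rightarrow> bool) \<Rightarrow> bool) set" where
  "balanced n =
     {f \<in> cube n \<rightarrow>\<^sub>E UNIV. card {x \<in> cube n. \<not> f x} = card {x \<in> cube n. f x}}"

definition protocols :: "nat \<Rightarrow> nat \<Rightarrow> (nat \<Rightarrow> (nat \<Rightarrow> bool) \<Rightarrow> bool) set" where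
  "protocols k n = {1..k} \<rightarrow>\<^sub>E balanced n"

definition agreement_prob ::
    "nat \<Rightarrow> nat \<Rightarrow> real \<Rightarrow> (nat \<Rightarrow> (nat \<Rightarrow> bool) \<Rightarrow> bool) \<Rightarrow> real" where
  "agreement_prob k n \<epsilon> f =
     measure_pmf.prob (source_model k n \<epsilon>)
       {(x, y). \<forall>i\<in>{1..k}. \<forall>j\<in>{1..k}. f i (y i) = f j (y j)}"

definition best_protocols ::
    "nat \<Rightarrow> nat \<Rightarrow> real \<Rightarrow> (nat \<Rightarrow> (nat \<Rightarrow> bool) \<Rightarrow> bool) set" where
  "best_protocols k n \<epsilon> =
     {f \<in> protocols k n. \<forall>g \<in> protocols k n. agreement_prob k n \<epsilon> g \<le> agreement_prob k n \<epsilon> f}"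

definition perm_flip ::
    "nat \<Rightarrow> (nat \<Rightarrow> nat) \<Rightarrow> nat set \<Rightarrow> (nat \<Rightarrow> bool) \<Rightarrow> nat \<Rightarrow> bool" where
  "perm_flip n \<pi> S x = (\<lambda>i\<in>{1..n}. if i \<in> S then x (\<pi> i) else \<not> x (\<pi> i))"

definition unique_best_protocol ::
    "nat \<Rightarrow> nat \<Rightarrow> real \<Rightarrow> (nat \<Rightarrow> (nat \<Rightarrow> bool) \<Rightarrow> bool) \<Rightarrow> bool" where
  "unique_best_protocol k n \<epsilon> f \<longleftrightarrow>
     best_protocols k n \<epsilon> =
       {(\<lambda>i\<in>{1..k}. \<lambda>x\<in>cube n. f i (perm_flip n \<pi> S x)) | S \<pi>.
          S \<subseteq> {1..n} \<and> \<pi> permutes {1..n}}"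

definition first_bit_protocol :: "nat \<Rightarrow> nat \<Rightarrow> nat \<Rightarrow> (nat \<Rightarrow> bool) \<Rightarrow> bool" where
  "first_bit_protocol k n = (\<lambda>i\<in>{1..k}. \<lambda>x\<in>cube n. x 1)"

text \<open>
  With a single party every protocol agrees with probability 1, so for \<open>n \<ge> 2\<close> the parity of
  the first two bits is a best protocol that is not a dictator. Uniqueness therefore fails.
\<close>

lemma perm_flip_in_cube: "perm_flip n \<pi> S x \<in> cube n"
  by (auto simp: perm_flip_def cube_def)

lemma not_unique_best_protocol_single_party:
  assumes n: "2 \<le> n"
  shows "\<not> unique_best_protocol 1 n \<epsilon> (first_bit_protocol 1 n)"
proof
  assume *: "unique_best_protocol 1 n \<epsilon> (first_bit_protocol 1 n)"
  define g where "g = (\<lambda>x\<in>cube n. x 1 \<noteq> x (2::nat))"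
  have flip: "x(q := \<not> x q) \<in> cube n" if "x \<in> cube n" "q \<in> {1..n}" for x q
    using that by (auto simp: cube_def PiE_def extensional_def)
  have g_eq: "g x \<longleftrightarrow> x 1 \<noteq> x 2" if "x \<in> cube n" for x
    using that by (simp add: g_def)
  let ?h = "\<lambda>x :: nat \<Rightarrow> bool. x(1 := \<not> x 1)"
  have h: "?h x \<in> cube n" "g (?h x) \<longleftrightarrow> \<not> g x" if "x \<in> cube n" for x
    using flip[OF that, of 1] n g_eq[OF that] g_eq[of "?h x"] by simp_all
  have "bij_betw ?h {x \<in> cube n. \<not> g x} {x \<in> cube n. g x}"
    by (rule bij_betw_byWitness[where f' = ?h]) (use h in auto)
  then have "card {x \<in> cube n. \<not> g x} = card {x \<in> cube n. g x}"
    by (rule bij_betw_same_card)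
  moreover have "g \<in> cube n \<rightarrow>\<^sub>E UNIV"
    by (simp add: g_def)
  ultimately have "g \<in> balanced n"
    by (simp add: balanced_def)
  then have "(\<lambda>i\<in>{1..1}. g) \<in> protocols 1 n"
    by (auto simp: protocols_def)
  moreover have "agreement_prob 1 n \<epsilon> f = 1" for f
    by (simp add: agreement_prob_def)
  ultimately have "(\<lambda>i\<in>{1..1}. g) \<in> best_protocols 1 n \<epsilon>"
    by (simp add: best_protocols_def)
  then obtain S \<pi> where \<pi>: "\<pi> permutes {1..n}" and eq: "(\<lambda>i\<in>{1..1}. g) =
      (\<lambda>i\<in>{1..1::nat}. \<lambda>x\<in>cube n. first_bit_protocol 1 n i (perm_flip n \<pi> S x))"
    using * unfolding unique_best_protocol_def by blast
  have g: "g x = (if 1 \<in> S then x (\<pi> 1) else \<not> x (\<pi> 1))" if "x \<in> cube n" for x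
    using fun_cong[OF fun_cong[OF eq, of 1], of x] that n
    by (simp add: first_bit_protocol_def perm_flip_in_cube) (simp add: perm_flip_def)
  define q :: nat where "q = (if \<pi> 1 = 1 then 2 else 1)"
  have q: "q \<in> {1, 2}" "q \<noteq> \<pi> 1" by (auto simp: q_def)
  define x where "x = (\<lambda>i\<in>{1..n}. False)"
  have x: "x \<in> cube n" by (auto simp: x_def cube_def)
  have x': "x(q := \<not> x q) \<in> cube n" using flip[OF x, of q] q n by auto
  have "g (x(q := \<not> x q)) = g x" using g[OF x] g[OF x'] q by simp
  then show False using q x x' by (auto simp: g_def)
qed

end

theory Submission
  imports Defs
begin

text \<open>
  Put \<open>\<rho> = 1 - 2\<epsilon>\<close> and regard bits as signs. Given \<open>x\<close>, the expected sign of \<open>f\<^sub>i(y\<^sup>i)\<close> is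
  \<open>T\<^sub>\<rho>f\<^sub>i(x) = \<Sum>\<^sub>S \<rho>\<^bsup>|S|\<^esup> c\<^sub>i(S) \<chi>\<^sub>S(x)\<close>, where \<open>c\<^sub>i(S)\<close> are the Walsh coefficients of \<open>f\<^sub>i\<close>, so the
  agreement probability is \<open>2\<^bsup>-k\<^esup> E(\<Prod>\<^sub>i(1 + T\<^sub>\<rho>f\<^sub>i) + \<Prod>\<^sub>i(1 - T\<^sub>\<rho>f\<^sub>i))\<close>, a polynomial in \<open>\<rho>\<close>.

  At \<open>\<rho> = 1\<close> it equals 1 exactly when all \<open>f\<^sub>i\<close> coincide, and then its derivative is
  \<open>(k/2) \<Sum>\<^sub>S |S| c(S)\<^sup>2\<close>. Near \<open>\<rho> = 0\<close> it is
  \<open>2\<^bsup>1-k\<^esup>(1 + (\<rho>\<^sup>2/2) \<Sum>\<^sub>i\<^sub>\<noteq>\<^sub>l \<Sum>\<^sub>j c\<^sub>i({j}) c\<^sub>l({j}))\<close> up to terms of order higher than \<open>\<rho>\<^sup>2\<close>.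
  Since \<open>\<Sum>\<^sub>S c(S)\<^sup>2 = 1\<close> and \<open>c({}) = 0\<close> for balanced functions, the first quantity is minimal, and
  the second one maximal, only if each \<open>f\<^sub>i\<close> has all its weight on the sets of size 1, and a balanced
  function with this property is a dictator. As there are finitely many protocols, these
  comparisons of leading terms hold uniformly in one-sided neighbourhoods of \<open>\<rho> = 1\<close> and \<open>\<rho> = 0\<close>.
\<close>

section \<open>Walsh expansions\<close>

definition bit_sign :: "bool \<Rightarrow> real" where
  "bit_sign b = (if b then 1 else - 1)"

definition walsh :: "nat set \<Rightarrow> (nat \<Rightarrow> bool) \<Rightarrow> real" where
  "walsh S x = (\<Prod>j\<in>S. bit_sign (x j))"

definition walsh_coeff :: "nat \<Rightarrow> ((nat \<Rightarrow> bool) \<Rightarrow> bool) \<Rightarrow> nat set \<Rightarrow> real" where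
  "walsh_coeff n f S = (\<Sum>x\<in>cube n. bit_sign (f x) * walsh S x) / 2 ^ n"

text \<open>Defining the noise operator by its Walsh expansion makes it a polynomial in \<rho>,
  defined for every real \<rho>, so derivatives and limits can be taken term by term. Its
  probabilistic meaning comes from the kernel form in \<open>noise_eq_kernel_sum\<close>.\<close>

definition noise :: "nat \<Rightarrow> real \<Rightarrow> ((nat \<Rightarrow> bool) \<Rightarrow> bool) \<Rightarrow> (nat \<Rightarrow> bool) \<Rightarrow> real" where
  "noise n \<rho> f x = (\<Sum>S\<in>Pow {1..n}. \<rho> ^ card S * walsh_coeff n f S * walsh S x)"

lemma bit_sign_square [simp]: "bit_sign b * bit_sign b = 1"
  by (simp add: bit_sign_def)

lemma bit_sign_eq_iff [simp]: "bit_sign a = bit_sign b \<longleftrightarrow> a = b"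
  by (auto simp: bit_sign_def)

lemma bit_sign_Not [simp]: "bit_sign (\<not> b) = - bit_sign b"
  by (simp add: bit_sign_def)

lemma walsh_empty [simp]: "walsh {} x = 1"
  by (simp add: walsh_def)

lemma walsh_singleton [simp]: "walsh {j} x = bit_sign (x j)"
  by (simp add: walsh_def)

lemma finite_cube [simp]: "finite (cube n)"
  by (simp add: cube_def finite_PiE)

lemma card_cube: "card (cube n) = 2 ^ n"
  by (simp add: cube_def card_PiE)

lemma cube_not_empty [simp]: "cube n \<noteq> {}"
  by (simp add: cube_def PiE_eq_empty_iff)

lemma cube_upd:
  assumes "x \<in> cube n" "j \<in> {1..n}"
  shows "x(j := b) \<in> cube n"
  using assms by (auto simp: cube_def PiE_def extensional_def)

lemma cube_eqI:
  assumes "x \<in> cube n" "y \<in> cube n" "\<And>j. j \<in> {1..n} \<Longrightarrow> x j = y j"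
  shows "x = y"
  using assms unfolding cube_def by (rule PiE_ext)

section \<open>Noise kernel, Walsh inversion and Parseval\<close>

lemma noise_kernel_expansion:
  "(\<Prod>j\<in>{1..n}. 1 + \<rho> * (bit_sign (x j) * bit_sign (y j))) =
     (\<Sum>S\<in>Pow {1..n}. \<rho> ^ card S * walsh S x * walsh S y)"
proof -
  have "(\<Prod>j\<in>{1..n}. \<rho> * (bit_sign (x j) * bit_sign (y j)) + 1) =
      (\<Sum>S\<in>Pow {1..n}. \<rho> ^ card S * walsh S x * walsh S y)"
    by (simp add: prod_add walsh_def prod.distrib mult.assoc)
  then show ?thesis by (simp add: add.commute)
qed

text \<open>The bridge to probability: for \<rho> = 1 - 2\<epsilon> the product is the chance that
  the noisy copy of \<open>x\<close> is \<open>y\<close>. As an identity of polynomials it holds for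
  all real \<rho>.\<close>

lemma noise_eq_kernel_sum:
  "noise n \<rho> f x =
     (\<Sum>y\<in>cube n. bit_sign (f y) * (\<Prod>j\<in>{1..n}. (1 + \<rho> * (bit_sign (x j) * bit_sign (y j))) / 2))"
proof -
  have "noise n \<rho> f x =
      (\<Sum>S\<in>Pow {1..n}. \<Sum>y\<in>cube n. bit_sign (f y) * (\<rho> ^ card S * walsh S x * walsh S y) / 2 ^ n)"
    by (simp add: noise_def walsh_coeff_def sum_distrib_left sum_distrib_right sum_divide_distrib
        mult_ac)
  also have "\<dots> = (\<Sum>y\<in>cube n. \<Sum>S\<in>Pow {1..n}.
      bit_sign (f y) * (\<rho> ^ card S * walsh S x * walsh S y) / 2 ^ n)"
    by (rule sum.swap)
  also have "\<dots> = (\<Sum>y\<in>cube n. bit_sign (f y) *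
      (\<Prod>j\<in>{1..n}. 1 + \<rho> * (bit_sign (x j) * bit_sign (y j))) / 2 ^ n)"
    by (simp only: noise_kernel_expansion sum_distrib_left sum_divide_distrib)
  finally show ?thesis by (simp add: prod_dividef)
qed

text \<open>At \<rho> = 1 a single disagreeing coordinate makes the kernel vanish, so only
  \<open>y = x\<close> survives. This is Walsh inversion.\<close>

lemma noise_one:
  assumes x: "x \<in> cube n"
  shows "noise n 1 f x = bit_sign (f x)"
proof -
  have "(\<Prod>j\<in>{1..n}. (1 + 1 * (bit_sign (x j) * bit_sign (y j))) / 2) = (if y = x then 1 else 0)"
    if "y \<in> cube n" for y
  proof (cases "y = x")
    case False
    then obtain j where "j \<in> {1..n}" "x j \<noteq> y j"
      using cube_eqI[of x n y] x \<open>y \<in> cube n\<close> by metis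
    then have "\<exists>j\<in>{1..n}. (1 + 1 * (bit_sign (x j) * bit_sign (y j))) / 2 = 0"
      by (intro bexI[of _ j]) (auto simp: bit_sign_def)
    with False show ?thesis by (simp add: prod_zero)
  qed simp
  then have "noise n 1 f x = (\<Sum>y\<in>cube n. bit_sign (f y) * (if y = x then 1 else 0))"
    unfolding noise_eq_kernel_sum by simp
  also have "\<dots> = (\<Sum>y\<in>cube n. if y = x then bit_sign (f y) else 0)"
    by (rule sum.cong) auto
  finally show ?thesis using x by simp
qed

text \<open>The weights \<open>c\<close> stay free because two choices are needed:
  \<open>c S = 1\<close> gives Parseval, and \<open>c S = real (card S)\<close> gives the derivative
  of the agreement at \<rho> = 1.\<close>

lemma noise_inner_self:
  "(\<Sum>x\<in>cube n. bit_sign (f x) * (\<Sum>S\<in>Pow {1..n}. c S * walsh_coeff n f S * walsh S x)) =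
     2 ^ n * (\<Sum>S\<in>Pow {1..n}. c S * (walsh_coeff n f S)\<^sup>2)"
proof -
  have "(\<Sum>x\<in>cube n. bit_sign (f x) * (\<Sum>S\<in>Pow {1..n}. c S * walsh_coeff n f S * walsh S x)) =
      (\<Sum>S\<in>Pow {1..n}. c S * walsh_coeff n f S * (\<Sum>x\<in>cube n. bit_sign (f x) * walsh S x))"
    unfolding sum_distrib_left by (subst sum.swap) (simp add: mult_ac)
  also have "\<dots> = (\<Sum>S\<in>Pow {1..n}. c S * walsh_coeff n f S * (2 ^ n * walsh_coeff n f S))"
    by (simp add: walsh_coeff_def)
  finally show ?thesis by (simp add: sum_distrib_left power2_eq_square mult_ac)
qed

lemma parseval: "(\<Sum>S\<in>Pow {1..n}. (walsh_coeff n f S)\<^sup>2) = 1"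
proof -
  have "2 ^ n * (\<Sum>S\<in>Pow {1..n}. 1 * (walsh_coeff n f S)\<^sup>2) =
      (\<Sum>x\<in>cube n. bit_sign (f x) * noise n 1 f x)"
    unfolding noise_def noise_inner_self[symmetric] by simp
  also have "\<dots> = 2 ^ n"
    by (simp add: noise_one card_cube)
  finally show ?thesis by simp
qed

lemma walsh_coeff_empty:
  assumes "f \<in> balanced n"
  shows "walsh_coeff n f {} = 0"
proof -
  have "(\<Sum>x\<in>cube n. bit_sign (f x)) =
      (\<Sum>x\<in>cube n. (if f x then 1 else 0)) - (\<Sum>x\<in>cube n. (if \<not> f x then 1 else 0))"
    unfolding sum_subtractf[symmetric] by (rule sum.cong) (auto simp: bit_sign_def)
  also have "\<dots> = 0"
    using assms by (simp add: balanced_def flip: sum.inter_filter)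
  finally show ?thesis by (simp add: walsh_coeff_def)
qed

section \<open>Functions of degree one\<close>

lemma sum_card_one:
  fixes h :: "nat set \<Rightarrow> real"
  assumes "\<And>S. S \<subseteq> {1..n} \<Longrightarrow> card S \<noteq> 1 \<Longrightarrow> h S = 0"
  shows "(\<Sum>S\<in>Pow {1..n}. h S) = (\<Sum>j\<in>{1..n}. h {j})"
proof -
  have "(\<Sum>j\<in>{1..n}. h {j}) = (\<Sum>S\<in>(\<lambda>j. {j}) ` {1..n}. h S)"
    by (simp add: sum.reindex)
  also have "\<dots> = (\<Sum>S\<in>Pow {1..n}. h S)"
  proof (intro sum.mono_neutral_left ballI)
    fix S assume "S \<in> Pow {1..n} - (\<lambda>j. {j}) ` {1..n}"
    moreover from this have "card S \<noteq> 1" by (auto simp: card_1_singleton_iff)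
    ultimately show "h S = 0" using assms by auto
  qed auto
  finally show ?thesis ..
qed

lemma degree_one_expansion:
  assumes "\<And>S. S \<subseteq> {1..n} \<Longrightarrow> card S \<noteq> 1 \<Longrightarrow> walsh_coeff n f S = 0" and "x \<in> cube n"
  shows "bit_sign (f x) = (\<Sum>j\<in>{1..n}. walsh_coeff n f {j} * bit_sign (x j))"
proof -
  have "bit_sign (f x) = noise n 1 f x" using assms(2) by (simp add: noise_one)
  also have "\<dots> = (\<Sum>j\<in>{1..n}. walsh_coeff n f {j} * bit_sign (x j))"
    unfolding noise_def by (subst sum_card_one) (simp_all add: assms(1))
  finally show ?thesis .
qed

definition dictator :: "nat \<Rightarrow> nat \<Rightarrow> bool \<Rightarrow> (nat \<Rightarrow> bool) \<Rightarrow> bool" where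
  "dictator n j s = (\<lambda>x\<in>cube n. x j = s)"

text \<open>Flipping bit \<open>j\<close> changes the sign of \<open>f\<close> by
  \<open>2 * c j\<close> up to sign, and a change of sign values can only be 0 or \<plusminus>2. So
  a nonzero \<open>c j\<close> is \<plusminus>1, it carries the whole Parseval weight, and no other
  coordinate matters.\<close>

lemma degree_one_imp_dictator:
  assumes f: "f \<in> balanced n"
    and deg: "\<And>S. S \<subseteq> {1..n} \<Longrightarrow> card S \<noteq> 1 \<Longrightarrow> walsh_coeff n f S = 0"
  shows "\<exists>j\<in>{1..n}. \<exists>s. f = dictator n j s"
proof -
  define c where "c = (\<lambda>j. walsh_coeff n f {j})"
  have expand: "bit_sign (f x) = (\<Sum>j\<in>{1..n}. c j * bit_sign (x j))" if "x \<in> cube n" for x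
    unfolding c_def using degree_one_expansion[OF deg that] by simp
  have norm: "(\<Sum>j\<in>{1..n}. (c j)\<^sup>2) = 1"
    unfolding c_def using sum_card_one[of n "\<lambda>S. (walsh_coeff n f S)\<^sup>2"] parseval[of n f] deg
    by simp
  then obtain j where j: "j \<in> {1..n}" "c j \<noteq> 0"
    by (metis (no_types, lifting) power_zero_numeral sum.neutral zero_neq_one)
  have unit: "(c j)\<^sup>2 = 1"
  proof -
    obtain x where x: "x \<in> cube n" by (metis cube_not_empty ex_in_conv)
    let ?y = "x(j := \<not> x j)"
    have y: "?y \<in> cube n" using cube_upd[OF x j(1)] .
    have "bit_sign (f x) - bit_sign (f ?y) =
        (\<Sum>i\<in>{1..n}. c i * (bit_sign (x i) - bit_sign (?y i)))"
      by (simp only: expand[OF x] expand[OF y] right_diff_distrib sum_subtractf)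
    also have "\<dots> = (\<Sum>i\<in>{1..n}. if i = j then 2 * c j * bit_sign (x j) else 0)"
      by (rule sum.cong) auto
    also have "\<dots> = 2 * c j * bit_sign (x j)"
      using j by simp
    finally have "c j = 1 \<or> c j = - 1"
      using j(2) by (auto simp: bit_sign_def split: if_splits)
    then show ?thesis by auto
  qed
  have "(\<Sum>i\<in>{1..n} - {j}. (c i)\<^sup>2) = 0"
    using norm unit j(1) by (simp add: sum.remove)
  then have others: "c i = 0" if "i \<in> {1..n} - {j}" for i
    using that by (subst (asm) sum_nonneg_eq_0_iff) auto
  define s where "s \<longleftrightarrow> c j = 1"
  have cj: "c j = bit_sign s"
    using unit by (auto simp: s_def bit_sign_def power2_eq_1_iff)
  have "f x = (x j = s)" if "x \<in> cube n" for x
  proof -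
    have "bit_sign (f x) = c j * bit_sign (x j)"
      using expand[OF that] others j(1) by (simp add: sum.remove)
    then show ?thesis by (auto simp: cj bit_sign_def split: if_splits)
  qed
  moreover have "f \<in> extensional (cube n)" using f by (auto simp: balanced_def PiE_def)
  ultimately have "f = dictator n j s"
    unfolding dictator_def by (intro extensionalityI[of _ "cube n"]) auto
  with j(1) show ?thesis by blast
qed

text \<open>Orthogonality of the coordinates: for distinct \<open>i\<close> and \<open>j\<close>,
  flipping bit \<open>i\<close> permutes the cube and negates the sum.\<close>

lemma sum_bit_sign_mult:
  assumes "i \<in> {1..n}" "j \<in> {1..n}"
  shows "(\<Sum>x\<in>cube n. bit_sign (x i) * bit_sign (x j)) = (if i = j then 2 ^ n else 0)"
proof (cases "i = j")
  case False
  let ?flip = "\<lambda>x :: nat \<Rightarrow> bool. x(i := \<not> x i)"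
  have "(\<Sum>x\<in>cube n. bit_sign (x i) * bit_sign (x j)) =
      (\<Sum>x\<in>cube n. bit_sign (?flip x i) * bit_sign (?flip x j))"
    by (rule sum.reindex_bij_witness[of _ ?flip ?flip])
       (use assms in \<open>auto intro!: cube_upd simp: fun_upd_idem_iff\<close>)
  also have "\<dots> = - (\<Sum>x\<in>cube n. bit_sign (x i) * bit_sign (x j))"
    using False by (simp add: sum_negf)
  finally show ?thesis using False by simp
qed (simp add: card_cube)

section \<open>The agreement probability\<close>

text \<open>The agreement probability as a polynomial on all of the reals. The divisor
  \<open>2 ^ n\<close> averages over \<open>x\<close>, and \<open>2 ^ k\<close> collects one factor
  1/2 per party.\<close>

definition agreement :: "nat \<Rightarrow> nat \<Rightarrow> (nat \<Rightarrow> (nat \<Rightarrow> bool) \<Rightarrow> bool) \<Rightarrow> real \<Rightarrow> real" where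
  "agreement k n f \<rho> = (\<Sum>x\<in>cube n.
     (\<Prod>i\<in>{1..k}. 1 + noise n \<rho> (f i) x) + (\<Prod>i\<in>{1..k}. 1 - noise n \<rho> (f i) x)) / (2 ^ n * 2 ^ k)"

text \<open>Each factor is \<open>1 - \<epsilon>\<close> if the two bits agree and \<epsilon> if
  they differ.\<close>

lemma pmf_noisy_copy:
  assumes "0 \<le> \<epsilon>" "\<epsilon> \<le> 1" and y: "y \<in> cube n"
  shows "pmf (noisy_copy n \<epsilon> x) y =
    (\<Prod>j\<in>{1..n}. (1 + (1 - 2 * \<epsilon>) * (bit_sign (x j) * bit_sign (y j))) / 2)"
proof -
  have pre: "(\<lambda>correct. if correct then a else \<not> a) -` {b} = {a = b}" for a b :: bool
    by auto
  have "pmf (noisy_copy n \<epsilon> x) y = (\<Prod>j\<in>{1..n}.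
      pmf (map_pmf (\<lambda>correct. if correct then x j else \<not> x j) (bernoulli_pmf (1 - \<epsilon>))) (y j))"
    unfolding noisy_copy_def by (rule pmf_Pi') (use y in \<open>auto simp: cube_def PiE_def extensional_def\<close>)
  also have "\<dots> = (\<Prod>j\<in>{1..n}. (1 + (1 - 2 * \<epsilon>) * (bit_sign (x j) * bit_sign (y j))) / 2)"
    using assms(1,2)
    by (intro prod.cong) (auto simp: pmf_map pre measure_pmf_single bit_sign_def field_simps)
  finally show ?thesis .
qed

lemma set_pmf_noisy_copy: "set_pmf (noisy_copy n \<epsilon> x) \<subseteq> cube n"
  using set_Pi_pmf_subset[of "{1..n}" "undefined :: bool"]
  by (auto simp: noisy_copy_def cube_def PiE_def extensional_def)

text \<open>By the kernel form, \<open>noise\<close> is the conditional mean of the sign of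
  \<open>f y\<close>. The indicators of the two outcomes are (1 + sign)/2 and (1 - sign)/2.\<close>

lemma prob_noisy_copy:
  assumes "0 \<le> \<epsilon>" "\<epsilon> \<le> 1"
  shows "measure_pmf.prob (noisy_copy n \<epsilon> x) {y. f y} = (1 + noise n (1 - 2 * \<epsilon>) f x) / 2"
    and "measure_pmf.prob (noisy_copy n \<epsilon> x) {y. \<not> f y} = (1 - noise n (1 - 2 * \<epsilon>) f x) / 2"
proof -
  let ?M = "noisy_copy n \<epsilon> x"
  have total: "(\<Sum>y\<in>cube n. pmf ?M y) = 1"
    by (rule sum_pmf_eq_1) (use set_pmf_noisy_copy in auto)
  have noise: "noise n (1 - 2 * \<epsilon>) f x = (\<Sum>y\<in>cube n. bit_sign (f y) * pmf ?M y)"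
    unfolding noise_eq_kernel_sum using assms by (simp add: pmf_noisy_copy)
  have prob: "measure_pmf.prob ?M {y. P y} = (\<Sum>y\<in>cube n. if P y then pmf ?M y else 0)" for P
  proof -
    have "measure_pmf.prob ?M {y. P y} = measure_pmf.prob ?M {y \<in> cube n. P y}"
      by (rule measure_prob_cong_0) (use set_pmf_noisy_copy in \<open>auto simp: set_pmf_eq\<close>)
    also have "\<dots> = (\<Sum>y | y \<in> cube n \<and> P y. pmf ?M y)"
      by (rule measure_measure_pmf_finite) simp
    finally show ?thesis by (simp add: sum.inter_filter)
  qed
  have "2 * measure_pmf.prob ?M {y. f y} = 1 + noise n (1 - 2 * \<epsilon>) f x"
  proof -
    have "1 + noise n (1 - 2 * \<epsilon>) f x = (\<Sum>y\<in>cube n. pmf ?M y + bit_sign (f y) * pmf ?M y)"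
      by (simp add: total noise sum.distrib)
    then show ?thesis
      unfolding prob sum_distrib_left by (auto intro!: sum.cong simp: bit_sign_def)
  qed
  then show "measure_pmf.prob ?M {y. f y} = (1 + noise n (1 - 2 * \<epsilon>) f x) / 2" by simp
  have "2 * measure_pmf.prob ?M {y. \<not> f y} = 1 - noise n (1 - 2 * \<epsilon>) f x"
  proof -
    have "1 - noise n (1 - 2 * \<epsilon>) f x = (\<Sum>y\<in>cube n. pmf ?M y - bit_sign (f y) * pmf ?M y)"
      by (simp add: total noise sum_subtractf)
    then show ?thesis
      unfolding prob sum_distrib_left by (auto intro!: sum.cong simp: bit_sign_def)
  qed
  then show "measure_pmf.prob ?M {y. \<not> f y} = (1 - noise n (1 - 2 * \<epsilon>) f x) / 2" by simp
qed

lemma agreement_prob_eq_agreement: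
  assumes k: "1 \<le> k" and "0 \<le> \<epsilon>" "\<epsilon> \<le> 1"
  shows "agreement_prob k n \<epsilon> f = agreement k n f (1 - 2 * \<epsilon>)"
proof -
  let ?\<rho> = "1 - 2 * \<epsilon>"
  let ?M = "\<lambda>x. Pi_pmf {1..k} undefined (\<lambda>i. noisy_copy n \<epsilon> x)"
  let ?E = "{y. \<forall>i\<in>{1..k}. \<forall>j\<in>{1..k}. f i (y i) = f j (y j)}"
  have cond: "measure_pmf.prob (?M x) ?E =
      ((\<Prod>i\<in>{1..k}. 1 + noise n ?\<rho> (f i) x) + (\<Prod>i\<in>{1..k}. 1 - noise n ?\<rho> (f i) x)) / 2 ^ k" for x
  proof -
    \<comment> \<open>Agreement means that all outputs are true or all are false. These two events
      are disjoint because there is at least one party, and each is a product event over the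
      independent copies.\<close>
    have "?E = Pi {1..k} (\<lambda>i. {y. f i y}) \<union> Pi {1..k} (\<lambda>i. {y. \<not> f i y})"
      unfolding Pi_def using k by blast
    moreover have "Pi {1..k} (\<lambda>i. {y. f i y}) \<inter> Pi {1..k} (\<lambda>i. {y. \<not> f i y}) = {}"
      using k by (auto simp: Pi_def)
    ultimately have "measure_pmf.prob (?M x) ?E =
        measure_pmf.prob (?M x) (Pi {1..k} (\<lambda>i. {y. f i y})) +
        measure_pmf.prob (?M x) (Pi {1..k} (\<lambda>i. {y. \<not> f i y}))"
      by (simp add: measure_pmf.finite_measure_Union)
    also have "\<dots> = (\<Prod>i\<in>{1..k}. (1 + noise n ?\<rho> (f i) x) / 2) +
        (\<Prod>i\<in>{1..k}. (1 - noise n ?\<rho> (f i) x) / 2)"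
      by (simp only: measure_Pi_pmf_Pi finite_atLeastAtMost prob_noisy_copy(2)[OF assms(2,3)])
         (simp only: prob_noisy_copy(1)[OF assms(2,3)])
    finally show ?thesis
      by (simp add: prod_dividef add_divide_distrib[of "prod _ _"])
  qed
  let ?A = "{(x :: nat \<Rightarrow> bool, y). \<forall>i\<in>{1..k}. \<forall>j\<in>{1..k}. f i (y i) = f j (y j)}"
  \<comment> \<open>Writing the probability as the mass of \<open>True\<close> under a pushforward
    lets the outer bind turn into an average over the cube.\<close>
  have "agreement_prob k n \<epsilon> f = pmf (map_pmf (\<lambda>z. z \<in> ?A) (source_model k n \<epsilon>)) True"
    by (simp add: agreement_prob_def pmf_map vimage_def)
  also have "\<dots> = (\<Sum>x\<in>cube n. measure_pmf.prob (?M x) ?E) / 2 ^ n"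
    by (simp add: source_model_def map_bind_pmf pmf.map_comp o_def pmf_bind integral_pmf_of_set
        card_cube pmf_map vimage_def)
  also have "\<dots> = agreement k n f ?\<rho>"
    unfolding cond agreement_def sum_divide_distrib by (simp add: mult.commute)
  finally show ?thesis .
qed

section \<open>Dictator protocols\<close>

definition dictator_protocols :: "nat \<Rightarrow> nat \<Rightarrow> (nat \<Rightarrow> (nat \<Rightarrow> bool) \<Rightarrow> bool) set" where
  "dictator_protocols k n = {(\<lambda>i\<in>{1..k}. dictator n j s) | j s. j \<in> {1..n}}"

lemma dictator_in_balanced:
  assumes j: "j \<in> {1..n}"
  shows "dictator n j s \<in> balanced n"
proof -
  let ?flip = "\<lambda>x :: nat \<Rightarrow> bool. x(j := \<not> x j)"
  have "bij_betw ?flip {x \<in> cube n. \<not> dictator n j s x} {x \<in> cube n. dictator n j s x}"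
    by (rule bij_betw_byWitness[where f' = ?flip]) (use j in \<open>auto simp: dictator_def cube_upd\<close>)
  then have "card {x \<in> cube n. \<not> dictator n j s x} = card {x \<in> cube n. dictator n j s x}"
    by (rule bij_betw_same_card)
  moreover have "dictator n j s \<in> cube n \<rightarrow>\<^sub>E UNIV"
    by (simp add: dictator_def)
  ultimately show ?thesis
    by (simp add: balanced_def)
qed

text \<open>Finiteness allows the neighbourhoods found for single protocols to be merged into
  one.\<close>

lemma finite_protocols: "finite (protocols k n)"
proof -
  have "finite (cube n \<rightarrow>\<^sub>E (UNIV :: bool set))"
    by (intro finite_PiE) auto
  then have "finite (balanced n)"
    by (rule finite_subset[rotated]) (auto simp: balanced_def)
  then show ?thesis
    by (auto simp: protocols_def intro: finite_PiE)
qed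

lemma dictator_protocols_subset: "dictator_protocols k n \<subseteq> protocols k n"
  using dictator_in_balanced by (auto simp: dictator_protocols_def protocols_def)

text \<open>The coefficient at \<open>{j}\<close> already exhausts the Parseval weight, so the
  others vanish without being computed.\<close>

lemma walsh_coeff_dictator:
  assumes j: "j \<in> {1..n}" and S: "S \<subseteq> {1..n}"
  shows "walsh_coeff n (dictator n j s) S = (if S = {j} then bit_sign s else 0)"
proof -
  let ?c = "walsh_coeff n (dictator n j s)"
  have "?c {j} = (\<Sum>x\<in>cube n. bit_sign s * (bit_sign (x j) * bit_sign (x j))) / 2 ^ n"
    unfolding walsh_coeff_def
    by (intro arg_cong2[where f = "(/)"] sum.cong) (auto simp: dictator_def bit_sign_def)
  also have "\<dots> = bit_sign s"
    by (simp add: card_cube)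
  finally have cj: "?c {j} = bit_sign s" .
  have "(\<Sum>T\<in>Pow {1..n}. (?c T)\<^sup>2) = (?c {j})\<^sup>2 + (\<Sum>T\<in>Pow {1..n} - {{j}}. (?c T)\<^sup>2)"
    using j by (intro sum.remove) auto
  then have "(\<Sum>T\<in>Pow {1..n} - {{j}}. (?c T)\<^sup>2) = 0"
    unfolding parseval cj by (simp add: power2_eq_square)
  then have "\<forall>T\<in>Pow {1..n} - {{j}}. (?c T)\<^sup>2 = 0"
    by (subst (asm) sum_nonneg_eq_0_iff) auto
  with cj S show ?thesis by auto
qed

lemma noise_dictator:
  assumes j: "j \<in> {1..n}"
  shows "noise n \<rho> (dictator n j s) x = \<rho> * (bit_sign s * bit_sign (x j))"
proof -
  have "noise n \<rho> (dictator n j s) x =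
      (\<Sum>S\<in>Pow {1..n}. if S = {j} then \<rho> * (bit_sign s * bit_sign (x j)) else 0)"
    unfolding noise_def by (rule sum.cong) (use walsh_coeff_dictator[OF j] in auto)
  also have "\<dots> = \<rho> * (bit_sign s * bit_sign (x j))"
    using j by simp
  finally show ?thesis .
qed

text \<open>For each \<open>x\<close> all parties have the same noise value, \<rho> or -\<rho>; its
  sign only decides which of the two products is which.\<close>

lemma agreement_dictator:
  assumes "f \<in> dictator_protocols k n"
  shows "agreement k n f \<rho> = ((1 + \<rho>) ^ k + (1 - \<rho>) ^ k) / 2 ^ k"
proof -
  obtain j s where j: "j \<in> {1..n}" and f: "f = (\<lambda>i\<in>{1..k}. dictator n j s)"
    using assms by (auto simp: dictator_protocols_def)
  have "(\<Prod>i\<in>{1..k}. 1 + noise n \<rho> (f i) x) + (\<Prod>i\<in>{1..k}. 1 - noise n \<rho> (f i) x) =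
      (1 + \<rho>) ^ k + (1 - \<rho>) ^ k" for x
    by (cases s; cases "x j") (simp_all add: f noise_dictator[OF j] bit_sign_def)
  then show ?thesis by (simp add: agreement_def card_cube)
qed

text \<open>The first output bit of \<open>perm_flip\<close> depends only on \<open>\<pi> 1\<close>
  and on whether 1 lies in \<open>S\<close>, so the orbit consists of all dictators and their
  negations, shared by all parties.\<close>

lemma perm_flip_first_bit_protocols:
  assumes n: "1 \<le> n"
  shows "{(\<lambda>i\<in>{1..k}. \<lambda>x\<in>cube n. first_bit_protocol k n i (perm_flip n \<pi> S x)) | S \<pi>.
      S \<subseteq> {1..n} \<and> \<pi> permutes {1..n}} = dictator_protocols k n"
    (is "?L = _")
proof -
  have eq: "(\<lambda>i\<in>{1..k}. \<lambda>x\<in>cube n. first_bit_protocol k n i (perm_flip n \<pi> S x)) =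
      (\<lambda>i\<in>{1..k}. dictator n (\<pi> 1) (1 \<in> S))" for \<pi> S
  proof -
    have "first_bit_protocol k n i (perm_flip n \<pi> S x) = (x (\<pi> 1) = (1 \<in> S))"
      if "i \<in> {1..k}" for i x
      using that n by (simp add: first_bit_protocol_def perm_flip_in_cube) (simp add: perm_flip_def)
    then show ?thesis
      unfolding dictator_def by (intro restrict_ext) simp
  qed
  show ?thesis
  proof (intro equalityI subsetI)
    fix f assume "f \<in> ?L"
    then obtain S :: "nat set" and \<pi> where "\<pi> permutes {1..n}" "f = (\<lambda>i\<in>{1..k}. dictator n (\<pi> 1) (1 \<in> S))"
      unfolding eq by blast
    moreover from this have "\<pi> 1 \<in> {1..n}"
      using n permutes_in_image[of \<pi> "{1..n}" 1] by simp
    ultimately show "f \<in> dictator_protocols k n"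
      unfolding dictator_protocols_def by blast
  next
    fix f assume "f \<in> dictator_protocols k n"
    then obtain j s where j: "j \<in> {1..n}" and f: "f = (\<lambda>i\<in>{1..k}. dictator n j s)"
      by (auto simp: dictator_protocols_def)
    \<comment> \<open>Only membership of 1 counts, so the full and the empty set suffice; the
      transposition of 1 and \<open>j\<close> sends 1 to \<open>j\<close>.\<close>
    define S where "S = (if s then {1..n} else {})"
    have "S \<subseteq> {1..n}" "(1 \<in> S) = s" "Transposition.transpose 1 j permutes {1..n}" "Transposition.transpose 1 j 1 = j"
      using n j by (auto simp: S_def intro!: permutes_swap_id)
    with f have "S \<subseteq> {1..n} \<and> Transposition.transpose 1 j permutes {1..n} \<and>
        f = (\<lambda>i\<in>{1..k}. dictator n (Transposition.transpose 1 j 1) (1 \<in> S))"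
      by simp
    then show "f \<in> ?L"
      unfolding eq by blast
  qed
qed

text \<open>Reduces the theorem to a strict inequality between polynomials in \<rho>: all dictator
  protocols share one value, and everything else must stay below it.\<close>

lemma unique_best_protocol_first_bitI:
  assumes "1 \<le> k" "1 \<le> n" "0 \<le> \<epsilon>" "\<epsilon> \<le> 1"
    and less: "\<And>f. f \<in> protocols k n - dictator_protocols k n \<Longrightarrow>
      agreement k n f (1 - 2 * \<epsilon>) < ((1 + (1 - 2 * \<epsilon>)) ^ k + (1 - (1 - 2 * \<epsilon>)) ^ k) / 2 ^ k"
  shows "unique_best_protocol k n \<epsilon> (first_bit_protocol k n)"
proof -
  let ?V = "((1 + (1 - 2 * \<epsilon>)) ^ k + (1 - (1 - 2 * \<epsilon>)) ^ k) / 2 ^ k"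
  have val: "agreement_prob k n \<epsilon> f = ?V" if "f \<in> dictator_protocols k n" for f
    using agreement_prob_eq_agreement[OF assms(1,3,4)] agreement_dictator[OF that] by simp
  have lt: "agreement_prob k n \<epsilon> f < ?V" if "f \<in> protocols k n" "f \<notin> dictator_protocols k n" for f
    using agreement_prob_eq_agreement[OF assms(1,3,4)] less that by simp
  obtain d where d: "d \<in> dictator_protocols k n"
    using \<open>1 \<le> n\<close> by (auto simp: dictator_protocols_def)
  have "best_protocols k n \<epsilon> = dictator_protocols k n"
  proof (intro equalityI subsetI)
    fix f assume "f \<in> best_protocols k n \<epsilon>"
    then have "f \<in> protocols k n" "agreement_prob k n \<epsilon> d \<le> agreement_prob k n \<epsilon> f"
      using d dictator_protocols_subset by (auto simp: best_protocols_def)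
    then show "f \<in> dictator_protocols k n"
      using lt[of f] val[OF d] by force
  next
    fix f assume f: "f \<in> dictator_protocols k n"
    have "agreement_prob k n \<epsilon> g \<le> agreement_prob k n \<epsilon> f" if "g \<in> protocols k n" for g
      using val[OF f] val[of g] lt[OF that] by force
    with f show "f \<in> best_protocols k n \<epsilon>"
      using dictator_protocols_subset by (auto simp: best_protocols_def)
  qed
  then show ?thesis
    unfolding unique_best_protocol_def perm_flip_first_bit_protocols[OF \<open>1 \<le> n\<close>] .
qed

section \<open>Small noise\<close>

text \<open>The squared coefficients sum to 1, and balance removes the empty set, so the mean degree
  is at least 1. A function that is not a dictator has weight on some set of size at least
  2.\<close>

lemma degree_sum_gt_one:
  assumes f: "f \<in> balanced n" and nd: "\<And>j s. j \<in> {1..n} \<Longrightarrow> f \<noteq> dictator n j s"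
  shows "1 < (\<Sum>S\<in>Pow {1..n}. real (card S) * (walsh_coeff n f S)\<^sup>2)"
proof -
  obtain T where T: "T \<subseteq> {1..n}" "card T \<noteq> 1" "walsh_coeff n f T \<noteq> 0"
    using degree_one_imp_dictator[OF f] nd by blast
  have pos: "1 \<le> card S" if "S \<subseteq> {1..n}" "walsh_coeff n f S \<noteq> 0" for S
    using that walsh_coeff_empty[OF f] finite_subset[OF that(1)] by (cases "S = {}") (auto simp: Suc_le_eq card_gt_0_iff)
  have "(\<Sum>S\<in>Pow {1..n}. (walsh_coeff n f S)\<^sup>2) <
      (\<Sum>S\<in>Pow {1..n}. real (card S) * (walsh_coeff n f S)\<^sup>2)"
  proof (rule sum_strict_mono_ex1)
    show "\<forall>S\<in>Pow {1..n}. (walsh_coeff n f S)\<^sup>2 \<le> real (card S) * (walsh_coeff n f S)\<^sup>2"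
    proof
      fix S assume "S \<in> Pow {1..n}"
      then show "(walsh_coeff n f S)\<^sup>2 \<le> real (card S) * (walsh_coeff n f S)\<^sup>2"
        using pos[of S] by (cases "walsh_coeff n f S = 0") auto
    qed
    have "1 < card T" using pos[OF T(1,3)] T(2) by simp
    then show "\<exists>S\<in>Pow {1..n}. (walsh_coeff n f S)\<^sup>2 < real (card S) * (walsh_coeff n f S)\<^sup>2"
      using T by (intro bexI[of _ T]) auto
  qed simp
  then show ?thesis by (simp only: parseval)
qed

lemma noise_has_derivative_one:
  "((\<lambda>\<rho>. noise n \<rho> f x) has_real_derivative
     (\<Sum>S\<in>Pow {1..n}. real (card S) * walsh_coeff n f S * walsh S x)) (at 1)"
  unfolding noise_def by (auto intro!: derivative_eq_intros sum.cong)

text \<open>At \<rho> = 1 one of the two bases is 2 and the other 0. As \<open>k \<ge> 2\<close>,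
  the factor \<open>0 ^ (k - 1)\<close> removes one term; what remains is an inner product evaluated
  by \<open>noise_inner_self\<close>.\<close>

lemma agreement_has_derivative_one:
  assumes k: "2 \<le> k" and f: "\<And>i. i \<in> {1..k} \<Longrightarrow> f i = h"
  shows "(agreement k n f has_real_derivative
     real k / 2 * (\<Sum>S\<in>Pow {1..n}. real (card S) * (walsh_coeff n h S)\<^sup>2)) (at 1)"
proof -
  let ?d = "\<lambda>x. \<Sum>S\<in>Pow {1..n}. real (card S) * walsh_coeff n h S * walsh S x"
  have eq: "agreement k n f =
      (\<lambda>\<rho>. (\<Sum>x\<in>cube n. (1 + noise n \<rho> h x) ^ k + (1 - noise n \<rho> h x) ^ k) / (2 ^ n * 2 ^ k))"
    by (simp add: agreement_def f fun_eq_iff)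
  have pt: "((\<lambda>\<rho>. (1 + noise n \<rho> h x) ^ k + (1 - noise n \<rho> h x) ^ k) has_real_derivative
      real k * 2 ^ (k - 1) * (bit_sign (h x) * ?d x)) (at 1)" if "x \<in> cube n" for x
  proof -
    have "((\<lambda>\<rho>. (1 + noise n \<rho> h x) ^ k + (1 - noise n \<rho> h x) ^ k) has_real_derivative
        real k * (?d x * (1 + noise n 1 h x) ^ (k - 1)) - real k * (?d x * (1 - noise n 1 h x) ^ (k - 1)))
        (at 1)"
      by (auto intro!: derivative_eq_intros noise_has_derivative_one)
    then show ?thesis
      using that k by (cases "h x") (simp_all add: noise_one bit_sign_def power_0_left mult_ac)
  qed
  have "(agreement k n f has_real_derivative
      (\<Sum>x\<in>cube n. real k * 2 ^ (k - 1) * (bit_sign (h x) * ?d x)) / (2 ^ n * 2 ^ k)) (at 1)"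
    unfolding eq by (intro DERIV_cdivide DERIV_sum pt)
  moreover have "(\<Sum>x\<in>cube n. real k * 2 ^ (k - 1) * (bit_sign (h x) * ?d x)) =
      real k * 2 ^ (k - 1) * (2 ^ n * (\<Sum>S\<in>Pow {1..n}. real (card S) * (walsh_coeff n h S)\<^sup>2))"
    unfolding sum_distrib_left[symmetric] noise_inner_self ..
  moreover have "(2::real) ^ k = 2 * 2 ^ (k - 1)" using k by (cases k) auto
  ultimately show ?thesis by simp
qed

text \<open>Without noise, the contribution of a point is \<open>2 ^ k\<close> if all parties agree
  there and 0 otherwise, so one point of disagreement costs a positive amount.\<close>

lemma agreement_one_less:
  assumes k: "1 \<le> k" and x: "x \<in> cube n" and ij: "i \<in> {1..k}" "j \<in> {1..k}" "f i x \<noteq> f j x"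
  shows "agreement k n f 1 < 1"
proof -
  let ?t = "\<lambda>x. (\<Prod>i\<in>{1..k}. 1 + bit_sign (f i x)) + (\<Prod>i\<in>{1..k}. 1 - bit_sign (f i x))"
  have zero: "(\<Prod>i\<in>{1..k}. 1 + bit_sign (f i y)) = 0" if "l \<in> {1..k}" "\<not> f l y" for y l
    using that by (intro prod_zero) (auto simp: bit_sign_def intro!: bexI[of _ l])
  have zero': "(\<Prod>i\<in>{1..k}. 1 - bit_sign (f i y)) = 0" if "l \<in> {1..k}" "f l y" for y l
    using that by (intro prod_zero) (auto simp: bit_sign_def intro!: bexI[of _ l])
  have le: "(\<Prod>i\<in>{1..k}. 1 + bit_sign (f i y)) \<le> 2 ^ k" "(\<Prod>i\<in>{1..k}. 1 - bit_sign (f i y)) \<le> 2 ^ k" for y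
    using prod_le_power[of "{1..k}" "\<lambda>i. 1 + bit_sign (f i y)" 2 k]
      prod_le_power[of "{1..k}" "\<lambda>i. 1 - bit_sign (f i y)" 2 k]
    by (auto simp: bit_sign_def)
  have one: "1 \<in> {1..k}" using k by simp
  \<comment> \<open>Whatever party 1 outputs at \<open>y\<close>, one of the two products
    vanishes.\<close>
  have "?t y \<le> 2 ^ k" for y
    using zero[OF one, of y] zero'[OF one, of y] le[of y] by linarith
  moreover have "?t x = 0"
    using ij zero[OF ij(1)] zero[OF ij(2)] zero'[OF ij(1)] zero'[OF ij(2)] by (metis add_0)
  ultimately have "(\<Sum>y\<in>cube n. ?t y) < (\<Sum>y\<in>cube n. 2 ^ k)"
    using x by (intro sum_strict_mono_ex1) (auto intro!: bexI[of _ x])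
  then show ?thesis
    by (simp add: agreement_def noise_one card_cube)
qed

text \<open>If all parties use the same function, the deficit \<open>?D\<close> vanishes at 1 and
  has negative derivative there, so it is positive just to the left. Otherwise it is positive at 1
  itself, and continuity suffices.\<close>

lemma agreement_less_near_one:
  assumes k: "2 \<le> k" and f: "f \<in> protocols k n" "f \<notin> dictator_protocols k n"
  shows "\<forall>\<^sub>F \<rho> in at_left 1. agreement k n f \<rho> < ((1 + \<rho>) ^ k + (1 - \<rho>) ^ k) / 2 ^ k"
proof -
  let ?D = "\<lambda>\<rho>. ((1 + \<rho>) ^ k + (1 - \<rho>) ^ k) / 2 ^ k - agreement k n f \<rho>"
  have bal: "f i \<in> balanced n" if "i \<in> {1..k}" for i
    using f that by (auto simp: protocols_def)
  show ?thesis
  proof (cases "\<exists>h. \<forall>i\<in>{1..k}. f i = h")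
    case True
    then obtain h where eq: "\<And>i. i \<in> {1..k} \<Longrightarrow> f i = h" by blast
    have h: "h \<in> balanced n" using bal[of 1] eq[of 1] k by simp
    have nd: "h \<noteq> dictator n j s" if "j \<in> {1..n}" for j s
    proof
      assume "h = dictator n j s"
      with eq f(1) have "f = (\<lambda>i\<in>{1..k}. dictator n j s)"
        by (intro extensionalityI[of _ "{1..k}"]) (auto simp: protocols_def PiE_def)
      with f(2) that show False by (auto simp: dictator_protocols_def)
    qed
    let ?W = "\<Sum>S\<in>Pow {1..n}. real (card S) * (walsh_coeff n h S)\<^sup>2"
    have z: "(0::real) ^ k = 0" and p: "(2::real) ^ k = 2 * 2 ^ (k - 1)"
      using k by (auto simp flip: power_Suc)
    have "((\<lambda>\<rho>::real. ((1 + \<rho>) ^ k + (1 - \<rho>) ^ k) / 2 ^ k) has_real_derivative real k / 2) (at 1)"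
      using p k by (auto intro!: derivative_eq_intros simp: power_0_left)
    then have der: "(?D has_real_derivative real k / 2 - real k / 2 * ?W) (at 1)"
      by (intro DERIV_diff agreement_has_derivative_one k eq)
    have neg: "real k / 2 - real k / 2 * ?W < 0"
      using degree_sum_gt_one[OF h nd] k by simp
    obtain d where "d > 0" and d: "\<And>h. 0 < h \<Longrightarrow> h < d \<Longrightarrow> ?D 1 < ?D (1 - h)"
      using has_real_derivative_neg_dec_left[OF der neg] by blast
    have "agreement k n f 1 = (\<Sum>x\<in>cube n. 2 ^ k) / (2 ^ n * 2 ^ k)"
      unfolding agreement_def
      by (intro arg_cong2[where f = "(/)"] sum.cong refl) (auto simp: noise_one eq bit_sign_def z)
    then have D1: "?D 1 = 0" by (simp add: card_cube z)
    have "0 < ?D \<rho>" if "\<rho> > 1 - d" "\<rho> < 1" for \<rho>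
      using d[of "1 - \<rho>"] that D1 by simp
    then show ?thesis
      unfolding eventually_at_left_field using \<open>d > 0\<close> by (intro exI[of _ "1 - d"]) auto
  next
    case False
    then obtain i where i: "i \<in> {1..k}" "f i \<noteq> f 1" by metis
    have "\<exists>x\<in>cube n. f i x \<noteq> f 1 x"
    proof (rule ccontr)
      assume "\<not> (\<exists>x\<in>cube n. f i x \<noteq> f 1 x)"
      then have "f i = f 1"
        using bal[OF i(1)] bal[of 1] k
        by (intro extensionalityI[of _ "cube n"]) (auto simp: balanced_def PiE_def)
      with i show False by simp
    qed
    then have "agreement k n f 1 < 1"
      using k i agreement_one_less[of k _ n i 1 f] by auto
    then have "0 < ?D 1" using k by (simp add: power_0_left)
    moreover have "(?D \<longlongrightarrow> ?D 1) (at_left 1)"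
      unfolding agreement_def noise_def by (intro tendsto_intros) auto
    ultimately have "\<forall>\<^sub>F \<rho> in at_left 1. 0 < ?D \<rho>"
      using order_tendstoD(1) by blast
    then show ?thesis by eventually_elim simp
  qed
qed

section \<open>Large noise\<close>

text \<open>The coefficients vary with \<rho> and only their limits are known. The linear term
  therefore keeps \<open>c i \<rho>\<close> exactly, and only the quadratic remainder passes to the
  limit, which is the second elementary symmetric polynomial of the \<open>L i\<close>.\<close>

lemma prod_second_order:
  fixes c :: "'a \<Rightarrow> real \<Rightarrow> real"
  assumes "finite I" "\<And>i. i \<in> I \<Longrightarrow> (c i \<longlongrightarrow> L i) (at 0 within A)"
  shows "\<exists>E. (\<forall>\<rho>. (\<Prod>i\<in>I. 1 + \<rho> * c i \<rho>) = 1 + \<rho> * (\<Sum>i\<in>I. c i \<rho>) + \<rho>\<^sup>2 * E \<rho>) \<and>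
    (E \<longlongrightarrow> ((\<Sum>i\<in>I. L i)\<^sup>2 - (\<Sum>i\<in>I. (L i)\<^sup>2)) / 2) (at 0 within A)"
  using assms
proof (induction I rule: finite_induct)
  case empty
  show ?case by (intro exI[of _ "\<lambda>_. 0"]) simp
next
  case (insert a I)
  from insert.IH insert.prems obtain E
    where E: "\<And>\<rho>. (\<Prod>i\<in>I. 1 + \<rho> * c i \<rho>) = 1 + \<rho> * (\<Sum>i\<in>I. c i \<rho>) + \<rho>\<^sup>2 * E \<rho>"
      and lim: "(E \<longlongrightarrow> ((\<Sum>i\<in>I. L i)\<^sup>2 - (\<Sum>i\<in>I. (L i)\<^sup>2)) / 2) (at 0 within A)"
    by auto
  \<comment> \<open>Multiplication by \<open>1 + \<rho> * c a \<rho>\<close> adds to the old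
    remainder a cross term and a term with an extra factor \<rho>, which vanishes in the
    limit.\<close>
  define E' where "E' = (\<lambda>\<rho>. E \<rho> + c a \<rho> * (\<Sum>i\<in>I. c i \<rho>) + \<rho> * c a \<rho> * E \<rho>)"
  have expand: "(\<Prod>i\<in>insert a I. 1 + \<rho> * c i \<rho>) = 1 + \<rho> * (\<Sum>i\<in>insert a I. c i \<rho>) + \<rho>\<^sup>2 * E' \<rho>" for \<rho>
    using insert.hyps by (simp add: E E'_def algebra_simps power2_eq_square)
  have "(E' \<longlongrightarrow> ((\<Sum>i\<in>I. L i)\<^sup>2 - (\<Sum>i\<in>I. (L i)\<^sup>2)) / 2 + L a * (\<Sum>i\<in>I. L i) +
      0 * L a * (((\<Sum>i\<in>I. L i)\<^sup>2 - (\<Sum>i\<in>I. (L i)\<^sup>2)) / 2)) (at 0 within A)"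
    unfolding E'_def using insert.prems by (intro tendsto_intros lim) auto
  moreover have "((\<Sum>i\<in>I. L i)\<^sup>2 - (\<Sum>i\<in>I. (L i)\<^sup>2)) / 2 + L a * (\<Sum>i\<in>I. L i) +
      0 * L a * (((\<Sum>i\<in>I. L i)\<^sup>2 - (\<Sum>i\<in>I. (L i)\<^sup>2)) / 2) =
      ((\<Sum>i\<in>insert a I. L i)\<^sup>2 - (\<Sum>i\<in>insert a I. (L i)\<^sup>2)) / 2"
    using insert.hyps by (simp add: power2_sum field_simps)
  ultimately have "(E' \<longlongrightarrow> ((\<Sum>i\<in>insert a I. L i)\<^sup>2 - (\<Sum>i\<in>insert a I. (L i)\<^sup>2)) / 2)
      (at 0 within A)"
    by (simp only:)
  with expand show ?case by blast
qed

text \<open>The second product is the first with \<open>c\<close> negated: the linear terms cancel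
  exactly and the quadratic limits add up.\<close>

lemma prod_plus_prod_second_order:
  fixes c :: "'a \<Rightarrow> real \<Rightarrow> real"
  assumes fin: "finite I" and lim: "\<And>i. i \<in> I \<Longrightarrow> (c i \<longlongrightarrow> L i) (at 0 within A)"
  shows "\<exists>E. (\<forall>\<rho>. (\<Prod>i\<in>I. 1 + \<rho> * c i \<rho>) + (\<Prod>i\<in>I. 1 - \<rho> * c i \<rho>) = 2 + \<rho>\<^sup>2 * E \<rho>) \<and>
    (E \<longlongrightarrow> (\<Sum>i\<in>I. L i)\<^sup>2 - (\<Sum>i\<in>I. (L i)\<^sup>2)) (at 0 within A)"
proof -
  let ?l = "((\<Sum>i\<in>I. L i)\<^sup>2 - (\<Sum>i\<in>I. (L i)\<^sup>2)) / 2"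
  obtain E1 where E1: "\<And>\<rho>. (\<Prod>i\<in>I. 1 + \<rho> * c i \<rho>) = 1 + \<rho> * (\<Sum>i\<in>I. c i \<rho>) + \<rho>\<^sup>2 * E1 \<rho>"
    and l1: "(E1 \<longlongrightarrow> ?l) (at 0 within A)"
    using prod_second_order[OF fin, of c L A] lim by auto
  obtain E2 where E2: "\<And>\<rho>. (\<Prod>i\<in>I. 1 - \<rho> * c i \<rho>) = 1 - \<rho> * (\<Sum>i\<in>I. c i \<rho>) + \<rho>\<^sup>2 * E2 \<rho>"
    and l2: "(E2 \<longlongrightarrow> ?l) (at 0 within A)"
    using prod_second_order[OF fin, of "\<lambda>i \<rho>. - c i \<rho>" "\<lambda>i. - L i" A] lim
    by (auto simp: sum_negf intro: tendsto_minus)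
  have "((\<lambda>\<rho>. E1 \<rho> + E2 \<rho>) \<longlongrightarrow> ?l + ?l) (at 0 within A)"
    by (intro tendsto_add l1 l2)
  then show ?thesis
    by (intro exI[of _ "\<lambda>\<rho>. E1 \<rho> + E2 \<rho>"]) (simp add: E1 E2 algebra_simps)
qed

section \<open>Level-one Walsh weights and their correlations\<close>

text \<open>For balanced \<open>f\<close> this is the derivative of \<open>noise\<close> with
  respect to \<rho> at 0, as \<open>noise_first_order\<close> shows.\<close>

definition linear_part :: "nat \<Rightarrow> ((nat \<Rightarrow> bool) \<Rightarrow> bool) \<Rightarrow> (nat \<Rightarrow> bool) \<Rightarrow> real" where
  "linear_part n f x = (\<Sum>j\<in>{1..n}. walsh_coeff n f {j} * bit_sign (x j))"

lemma noise_first_order: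
  assumes f: "f \<in> balanced n"
  shows "\<exists>c. (\<forall>\<rho>. noise n \<rho> f x = \<rho> * c \<rho>) \<and> (c \<longlongrightarrow> linear_part n f x) (at 0 within A)"
proof -
  \<comment> \<open>For the empty set the truncated exponent \<open>card S - 1\<close> is 0 rather
    than -1; this is harmless, since balance makes that coefficient vanish.\<close>
  define c where "c = (\<lambda>\<rho>. \<Sum>S\<in>Pow {1..n}. \<rho> ^ (card S - 1) * walsh_coeff n f S * walsh S x)"
  have "\<rho> ^ card S * walsh_coeff n f S * walsh S x =
      \<rho> * (\<rho> ^ (card S - 1) * walsh_coeff n f S * walsh S x)" if "S \<in> Pow {1..n}" for \<rho> S
  proof (cases "S = {}")
    case False
    then have "card S = Suc (card S - 1)"
      using that finite_subset[of S "{1..n}"] by (simp add: card_gt_0_iff)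
    then have "\<rho> ^ card S = \<rho> * \<rho> ^ (card S - 1)" by (metis power_Suc)
    then show ?thesis by simp
  qed (simp add: walsh_coeff_empty[OF f])
  then have "noise n \<rho> f x = \<rho> * c \<rho>" for \<rho>
    unfolding noise_def c_def sum_distrib_left by (intro sum.cong refl)
  moreover have "(c \<longlongrightarrow> c 0) (at 0 within A)"
    unfolding c_def by (intro tendsto_intros)
  moreover have "c 0 = linear_part n f x"
  proof -
    have "0 ^ (card S - 1) * walsh_coeff n f S * walsh S x = 0"
      if "S \<subseteq> {1..n}" "card S \<noteq> 1" for S
    proof (cases "S = {}")
      case False
      then have "card S - 1 \<noteq> 0"
        using that finite_subset[of S "{1..n}"] card_gt_0_iff[of S] by auto
      then show ?thesis by (simp add: power_0_left)
    qed (simp add: walsh_coeff_empty[OF f])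
    then show ?thesis
      unfolding c_def linear_part_def by (subst sum_card_one) simp_all
  qed
  ultimately show ?thesis by auto
qed

lemma sum_linear_part_mult:
  "(\<Sum>x\<in>cube n. linear_part n f x * linear_part n g x) =
     2 ^ n * (\<Sum>j\<in>{1..n}. walsh_coeff n f {j} * walsh_coeff n g {j})"
proof -
  let ?a = "\<lambda>j. walsh_coeff n f {j}" and ?b = "\<lambda>j. walsh_coeff n g {j}"
  have "(\<Sum>x\<in>cube n. linear_part n f x * linear_part n g x) =
      (\<Sum>x\<in>cube n. \<Sum>i\<in>{1..n}. \<Sum>j\<in>{1..n}. ?a i * ?b j * (bit_sign (x i) * bit_sign (x j)))"
    by (simp add: linear_part_def sum_product mult_ac)
  also have "\<dots> = (\<Sum>i\<in>{1..n}. \<Sum>j\<in>{1..n}. \<Sum>x\<in>cube n.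
      ?a i * ?b j * (bit_sign (x i) * bit_sign (x j)))"
    by (subst sum.swap, intro sum.cong refl, rule sum.swap)
  also have "\<dots> = (\<Sum>i\<in>{1..n}. \<Sum>j\<in>{1..n}. ?a i * ?b j * (if i = j then 2 ^ n else 0))"
    by (intro sum.cong refl) (simp only: sum_distrib_left[symmetric] sum_bit_sign_mult)
  also have "\<dots> = (\<Sum>i\<in>{1..n}. \<Sum>j\<in>{1..n}. if i = j then ?a i * ?b i * 2 ^ n else 0)"
    by (intro sum.cong refl) auto
  finally show ?thesis by (simp add: sum_distrib_left mult_ac)
qed

lemma sum_degree_one_le_one: "(\<Sum>j\<in>{1..n}. (walsh_coeff n f {j})\<^sup>2) \<le> 1"
proof -
  have "(\<Sum>j\<in>{1..n}. (walsh_coeff n f {j})\<^sup>2) = (\<Sum>S\<in>(\<lambda>j. {j}) ` {1..n}. (walsh_coeff n f S)\<^sup>2)"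
    by (simp add: sum.reindex)
  also have "\<dots> \<le> (\<Sum>S\<in>Pow {1..n}. (walsh_coeff n f S)\<^sup>2)"
    by (intro sum_mono2) auto
  finally show ?thesis by (simp only: parseval)
qed

lemma sum_degree_one_eq_one:
  assumes "(\<Sum>j\<in>{1..n}. (walsh_coeff n f {j})\<^sup>2) = 1" "S \<subseteq> {1..n}" "card S \<noteq> 1"
  shows "walsh_coeff n f S = 0"
proof -
  let ?I = "(\<lambda>j. {j}) ` {1..n}"
  have "(\<Sum>T\<in>Pow {1..n}. (walsh_coeff n f T)\<^sup>2) =
      (\<Sum>T\<in>Pow {1..n} - ?I. (walsh_coeff n f T)\<^sup>2) + (\<Sum>T\<in>?I. (walsh_coeff n f T)\<^sup>2)"
    by (intro sum.subset_diff) auto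
  moreover have "(\<Sum>T\<in>?I. (walsh_coeff n f T)\<^sup>2) = 1"
    using assms(1) by (simp add: sum.reindex)
  ultimately have "(\<Sum>T\<in>Pow {1..n} - ?I. (walsh_coeff n f T)\<^sup>2) = 0"
    unfolding parseval by simp
  then have "\<forall>T\<in>Pow {1..n} - ?I. (walsh_coeff n f T)\<^sup>2 = 0"
    by (subst (asm) sum_nonneg_eq_0_iff) auto
  moreover have "S \<in> Pow {1..n} - ?I" using assms(2,3) by auto
  ultimately show ?thesis by auto
qed

text \<open>Both claims follow from expanding the squared distance of two level-one vectors of norm
  at most 1: correlation 1 forces equal vectors of norm 1.\<close>

lemma linear_correlation_le_one:
  "(\<Sum>j\<in>{1..n}. walsh_coeff n f {j} * walsh_coeff n g {j}) \<le> 1" (is "?G \<le> 1")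
  and linear_correlation_eq_one:
    "1 \<le> (\<Sum>j\<in>{1..n}. walsh_coeff n f {j} * walsh_coeff n g {j}) \<Longrightarrow>
      (\<Sum>j\<in>{1..n}. (walsh_coeff n f {j})\<^sup>2) = 1 \<and>
      (\<forall>j\<in>{1..n}. walsh_coeff n f {j} = walsh_coeff n g {j})"
proof -
  let ?a = "\<lambda>j. walsh_coeff n f {j}" and ?b = "\<lambda>j. walsh_coeff n g {j}"
  have eq: "(\<Sum>j\<in>{1..n}. (?a j - ?b j)\<^sup>2) = (\<Sum>j\<in>{1..n}. (?a j)\<^sup>2) + (\<Sum>j\<in>{1..n}. (?b j)\<^sup>2) - 2 * ?G"
    by (simp add: power2_diff sum.distrib sum_subtractf sum_distrib_left mult.assoc)
  have nonneg: "0 \<le> (\<Sum>j\<in>{1..n}. (?a j - ?b j)\<^sup>2)" by (simp add: sum_nonneg)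
  show "?G \<le> 1"
    using eq nonneg sum_degree_one_le_one[of n f] sum_degree_one_le_one[of n g] by linarith
  assume "1 \<le> ?G"
  then have "(\<Sum>j\<in>{1..n}. (?a j - ?b j)\<^sup>2) = 0" and one: "(\<Sum>j\<in>{1..n}. (?a j)\<^sup>2) = 1"
    using eq nonneg sum_degree_one_le_one[of n f] sum_degree_one_le_one[of n g] by linarith+
  then have "\<forall>j\<in>{1..n}. (?a j - ?b j)\<^sup>2 = 0"
    by (subst (asm) sum_nonneg_eq_0_iff) auto
  with one show "(\<Sum>j\<in>{1..n}. (?a j)\<^sup>2) = 1 \<and> (\<forall>j\<in>{1..n}. ?a j = ?b j)" by auto
qed

text \<open>Correlation 1 with some other party puts all weight of \<open>f i\<close> on singletons
  and gives it the coefficients of that party. So \<open>f 1\<close> is a dictator and every other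
  party equals it.\<close>

lemma linear_correlations_eq_one_imp_dictator:
  assumes k: "2 \<le> k" and f: "f \<in> protocols k n"
    and corr: "\<And>i l. i \<in> {1..k} \<Longrightarrow> l \<in> {1..k} \<Longrightarrow> i \<noteq> l \<Longrightarrow>
      1 \<le> (\<Sum>j\<in>{1..n}. walsh_coeff n (f i) {j} * walsh_coeff n (f l) {j})"
  shows "f \<in> dictator_protocols k n"
proof -
  have bal: "f i \<in> balanced n" if "i \<in> {1..k}" for i
    using f that by (auto simp: protocols_def)
  have deg: "walsh_coeff n (f i) S = 0" if "i \<in> {1..k}" "S \<subseteq> {1..n}" "card S \<noteq> 1" for i S
  proof -
    have "(if i = 1 then 2 else 1) \<in> {1..k}" "i \<noteq> (if i = 1 then 2 else 1)"
      using k by auto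
    from linear_correlation_eq_one[OF corr[OF that(1) this]] show ?thesis
      using sum_degree_one_eq_one that(2,3) by blast
  qed
  have one: "1 \<in> {1..k}" using k by simp
  obtain j s where j: "j \<in> {1..n}" "f 1 = dictator n j s"
    using degree_one_imp_dictator[OF bal[OF one] deg[OF one]] by blast
  have "f i = f 1" if i: "i \<in> {1..k}" for i
  proof (cases "i = 1")
    case False
    have "f i x = f 1 x" if x: "x \<in> cube n" for x
    proof -
      have "bit_sign (f l x) = (\<Sum>j\<in>{1..n}. walsh_coeff n (f l) {j} * bit_sign (x j))"
        if "l \<in> {1..k}" for l
        using deg that x by (intro degree_one_expansion) auto
      then have "bit_sign (f i x) = bit_sign (f 1 x)"
        using i one linear_correlation_eq_one[OF corr[OF i one False]] by simp
      then show ?thesis by simp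
    qed
    then show ?thesis
      using bal[OF i] bal[OF one]
      by (intro extensionalityI[of _ "cube n"]) (auto simp: balanced_def PiE_def)
  qed simp
  then have "f i = dictator n j s" if "i \<in> {1..k}" for i
    using that j(2) by metis
  then have "f = (\<lambda>i\<in>{1..k}. dictator n j s)"
    using f by (intro extensionalityI[of _ "{1..k}"]) (auto simp: protocols_def PiE_def)
  with j(1) show ?thesis by (auto simp: dictator_protocols_def)
qed

lemma sum_square_minus_sum_squares:
  fixes L :: "'a \<Rightarrow> real"
  assumes "finite I"
  shows "(\<Sum>i\<in>I. L i)\<^sup>2 - (\<Sum>i\<in>I. (L i)\<^sup>2) = (\<Sum>i\<in>I. \<Sum>l\<in>I. if i = l then 0 else L i * L l)"
proof -
  have "(\<Sum>i\<in>I. \<Sum>l\<in>I. if i = l then 0 else L i * L l) =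
      (\<Sum>i\<in>I. \<Sum>l\<in>I. L i * L l - (if i = l then (L i)\<^sup>2 else 0))"
    by (intro sum.cong refl) (auto simp: power2_eq_square)
  also have "\<dots> = (\<Sum>i\<in>I. L i)\<^sup>2 - (\<Sum>i\<in>I. (L i)\<^sup>2)"
    using assms by (simp add: sum_subtractf power2_eq_square sum_product)
  finally show ?thesis ..
qed

text \<open>Averaging over \<open>x\<close> turns the left side into a sum of correlations over the
  \<open>k\<^sup>2 - k\<close> ordered pairs of distinct parties. Each is at most 1, and for a
  non-dictator protocol one is smaller.\<close>

lemma second_order_less:
  assumes k: "2 \<le> k" and f: "f \<in> protocols k n" "f \<notin> dictator_protocols k n"
  shows "(\<Sum>x\<in>cube n. (\<Sum>i\<in>{1..k}. linear_part n (f i) x)\<^sup>2 - (\<Sum>i\<in>{1..k}. (linear_part n (f i) x)\<^sup>2))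
    < 2 ^ n * ((real k)\<^sup>2 - real k)"
proof -
  let ?G = "\<lambda>i l. \<Sum>j\<in>{1..n}. walsh_coeff n (f i) {j} * walsh_coeff n (f l) {j}"
  let ?g = "\<lambda>i l. if i = l then 0 else ?G i l"
  have "(\<Sum>x\<in>cube n. (\<Sum>i\<in>{1..k}. linear_part n (f i) x)\<^sup>2 - (\<Sum>i\<in>{1..k}. (linear_part n (f i) x)\<^sup>2)) =
      (\<Sum>x\<in>cube n. \<Sum>i\<in>{1..k}. \<Sum>l\<in>{1..k}.
        if i = l then 0 else linear_part n (f i) x * linear_part n (f l) x)"
    by (intro sum.cong refl sum_square_minus_sum_squares) simp
  also have "\<dots> = (\<Sum>i\<in>{1..k}. \<Sum>l\<in>{1..k}. \<Sum>x\<in>cube n.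
        if i = l then 0 else linear_part n (f i) x * linear_part n (f l) x)"
    by (subst sum.swap, intro sum.cong refl, rule sum.swap)
  also have "\<dots> = (\<Sum>i\<in>{1..k}. \<Sum>l\<in>{1..k}. 2 ^ n * ?g i l)"
    by (intro sum.cong refl) (simp add: sum_linear_part_mult)
  also have "\<dots> = 2 ^ n * (\<Sum>i\<in>{1..k}. \<Sum>l\<in>{1..k}. ?g i l)"
    by (simp only: sum_distrib_left)
  also have "\<dots> < 2 ^ n * (\<Sum>i\<in>{1..k}. \<Sum>l\<in>{1..k}. if i = l then 0 else 1)"
  proof -
    obtain i l where il: "i \<in> {1..k}" "l \<in> {1..k}" "i \<noteq> l" "?G i l < 1"
      using linear_correlations_eq_one_imp_dictator[OF k f(1)] f(2) by (meson not_le)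
    have le: "?g i l \<le> (if i = l then 0 else 1)" for i l
      using linear_correlation_le_one[of n "f i" "f l"] by simp
    have "(\<Sum>l\<in>{1..k}. ?g i l) < (\<Sum>l\<in>{1..k}. if i = l then 0 else 1)"
      by (rule sum_strict_mono_ex1) (use il le in \<open>auto intro!: bexI[of _ l]\<close>)
    then have "(\<Sum>i\<in>{1..k}. \<Sum>l\<in>{1..k}. ?g i l) < (\<Sum>i\<in>{1..k}. \<Sum>l\<in>{1..k}. if i = l then 0 else 1)"
      using il(1) le by (intro sum_strict_mono_ex1) (auto intro!: sum_mono)
    then show ?thesis by simp
  qed
  also have "(\<Sum>i\<in>{1..k}. \<Sum>l\<in>{1..k}. if i = l then 0 else 1) = (real k)\<^sup>2 - real k"
    \<comment> \<open>The same identity with all values 1 counts the ordered pairs.\<close>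
    using sum_square_minus_sum_squares[of "{1..k}" "\<lambda>_. 1"] by (simp cong: if_cong)
  finally show ?thesis .
qed

text \<open>Both sides have the same constant term and no linear term, so for small positive \<rho>
  the limits of their quadratic remainders decide.\<close>

lemma agreement_less_near_zero:
  assumes k: "2 \<le> k" and f: "f \<in> protocols k n" "f \<notin> dictator_protocols k n"
  shows "\<forall>\<^sub>F \<rho> in at_right 0. agreement k n f \<rho> < ((1 + \<rho>) ^ k + (1 - \<rho>) ^ k) / 2 ^ k"
proof -
  let ?L = "\<lambda>x. (\<Sum>i\<in>{1..k}. linear_part n (f i) x)\<^sup>2 - (\<Sum>i\<in>{1..k}. (linear_part n (f i) x)\<^sup>2)"
  have bal: "f i \<in> balanced n" if "i \<in> {1..k}" for i
    using f that by (auto simp: protocols_def)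
  have "\<exists>E. (\<forall>\<rho>. (\<Prod>i\<in>{1..k}. 1 + noise n \<rho> (f i) x) + (\<Prod>i\<in>{1..k}. 1 - noise n \<rho> (f i) x) =
      2 + \<rho>\<^sup>2 * E \<rho>) \<and> (E \<longlongrightarrow> ?L x) (at_right 0)" for x
  proof -
    have "\<forall>i\<in>{1..k}. \<exists>c. (\<forall>\<rho>. noise n \<rho> (f i) x = \<rho> * c \<rho>) \<and>
        (c \<longlongrightarrow> linear_part n (f i) x) (at_right 0)"
      using noise_first_order[OF bal] by blast
    then obtain c where "\<forall>i\<in>{1..k}. (\<forall>\<rho>. noise n \<rho> (f i) x = \<rho> * c i \<rho>) \<and>
        (c i \<longlongrightarrow> linear_part n (f i) x) (at_right 0)"
      by metis
    then show ?thesis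
      using prod_plus_prod_second_order[of "{1..k}" c "\<lambda>i. linear_part n (f i) x" "{0<..}"] by simp
  qed
  then obtain E where E: "\<And>x \<rho>. (\<Prod>i\<in>{1..k}. 1 + noise n \<rho> (f i) x) +
      (\<Prod>i\<in>{1..k}. 1 - noise n \<rho> (f i) x) = 2 + \<rho>\<^sup>2 * E x \<rho>"
    and limE: "\<And>x. (E x \<longlongrightarrow> ?L x) (at_right 0)"
    by metis
  obtain F where F: "\<And>\<rho>. (1 + \<rho>) ^ k + (1 - \<rho>) ^ k = 2 + \<rho>\<^sup>2 * F \<rho>"
    and limF: "(F \<longlongrightarrow> (real k)\<^sup>2 - real k) (at_right 0)"
    \<comment> \<open>The dictator value is the case of constant coefficients 1.\<close>
    using prod_plus_prod_second_order[of "{1..k}" "\<lambda>_ _. 1" "\<lambda>_. 1" "{0<..}"] by auto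
  have "((\<lambda>\<rho>. 2 ^ n * F \<rho> - (\<Sum>x\<in>cube n. E x \<rho>)) \<longlongrightarrow>
      2 ^ n * ((real k)\<^sup>2 - real k) - (\<Sum>x\<in>cube n. ?L x)) (at_right 0)"
    by (intro tendsto_intros limE limF)
  then have "\<forall>\<^sub>F \<rho> in at_right 0. 0 < 2 ^ n * F \<rho> - (\<Sum>x\<in>cube n. E x \<rho>)"
    using second_order_less[OF k f] by (intro order_tendstoD(1)) auto
  moreover have "\<forall>\<^sub>F \<rho>::real in at_right 0. 0 < \<rho>"
    by (rule eventually_at_right_less)
  ultimately show ?thesis
  proof eventually_elim
    case (elim \<rho>)
    have "agreement k n f \<rho> = (2 ^ n * 2 + \<rho>\<^sup>2 * (\<Sum>x\<in>cube n. E x \<rho>)) / (2 ^ n * 2 ^ k)"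
      unfolding agreement_def E by (simp add: sum.distrib card_cube sum_distrib_left)
    also have "\<dots> < (2 ^ n * 2 + \<rho>\<^sup>2 * (2 ^ n * F \<rho>)) / (2 ^ n * 2 ^ k)"
      using elim by (intro divide_strict_right_mono add_strict_left_mono mult_strict_left_mono) auto
    also have "\<dots> = (2 + \<rho>\<^sup>2 * F \<rho>) / 2 ^ k"
      by (simp add: field_simps)
    finally show ?case by (simp only: F)
  qed
qed

section \<open>The one-bit, one-party case and the choice of thresholds\<close>

text \<open>Treats the remaining case with \<open>k = 1\<close>, which the comparisons for
  \<open>k \<ge> 2\<close> do not reach: on one bit, balance leaves only the coefficient at
  \<open>{1}\<close>.\<close>

lemma protocols_one_one: "protocols 1 1 \<subseteq> dictator_protocols 1 1"
proof
  fix f assume f: "f \<in> protocols 1 1"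
  then have bal: "f 1 \<in> balanced 1" by (auto simp: protocols_def)
  have "walsh_coeff 1 (f 1) S = 0" if "S \<subseteq> {1..1}" "card S \<noteq> 1" for S
    using that walsh_coeff_empty[OF bal] by (auto simp: subset_singleton_iff)
  then obtain j s where j: "j \<in> {1..1}" "f 1 = dictator 1 j s"
    using degree_one_imp_dictator[OF bal] by blast
  then have "f = (\<lambda>i\<in>{1..1}. dictator 1 j s)"
    using f by (intro extensionalityI[of _ "{1..1}"]) (auto simp: protocols_def PiE_def)
  with j(1) show "f \<in> dictator_protocols 1 1"
    unfolding dictator_protocols_def by blast
qed

text \<open>The excluded case is exactly the one refuted by
  \<open>not_unique_best_protocol_single_party\<close>.\<close>

theorem theorem1p6:
  fixes k n :: nat
  assumes "1 \<le> k" and "1 \<le> n" and "\<not> (k = 1 \<and> 2 \<le> n)"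
  shows "\<exists>\<epsilon>' \<epsilon>'' :: real. 0 < \<epsilon>' \<and> \<epsilon>' < \<epsilon>'' \<and> \<epsilon>'' < 1/2 \<and>
           (\<forall>\<epsilon>. (0 < \<epsilon> \<and> \<epsilon> < \<epsilon>') \<or> (\<epsilon>'' < \<epsilon> \<and> \<epsilon> < 1/2) \<longrightarrow>
              unique_best_protocol k n \<epsilon> (first_bit_protocol k n))"
proof -
  let ?P = "\<lambda>\<rho>. \<forall>f\<in>protocols k n - dictator_protocols k n.
    agreement k n f \<rho> < ((1 + \<rho>) ^ k + (1 - \<rho>) ^ k) / 2 ^ k"
  have "eventually ?P (at_left 1) \<and> eventually ?P (at_right 0)"
  proof (cases "k = 1")
    case True
    with assms have "n = 1" by simp
    with True have "?P \<rho>" for \<rho>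
      using protocols_one_one by blast
    then show ?thesis by simp
  next
    case False
    with assms have "2 \<le> k" by simp
    then show ?thesis
      using agreement_less_near_one agreement_less_near_zero
      by (intro conjI eventually_ball_finite) (auto simp: finite_protocols)
  qed
  then obtain b c where "b < 1" and b: "\<And>\<rho>. b < \<rho> \<Longrightarrow> \<rho> < 1 \<Longrightarrow> ?P \<rho>"
    and "0 < c" and c: "\<And>\<rho>. 0 < \<rho> \<Longrightarrow> \<rho> < c \<Longrightarrow> ?P \<rho>"
    unfolding eventually_at_left_field eventually_at_right_field by metis
  \<comment> \<open>The bounds on \<rho> = 1 - 2\<epsilon> are translated into bounds on \<epsilon>.
    The caps 1/8 and 3/8 keep the two thresholds in order and strictly between 0 and 1/2.\<close>
  define \<epsilon>' where "\<epsilon>' = min ((1 - b) / 2) (1 / 8)"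
  define \<epsilon>'' where "\<epsilon>'' = max ((1 - c) / 2) (3 / 8)"
  have "unique_best_protocol k n \<epsilon> (first_bit_protocol k n)"
    if "(0 < \<epsilon> \<and> \<epsilon> < \<epsilon>') \<or> (\<epsilon>'' < \<epsilon> \<and> \<epsilon> < 1/2)" for \<epsilon>
  proof -
    have "?P (1 - 2 * \<epsilon>)"
      using that
    proof
      assume "0 < \<epsilon> \<and> \<epsilon> < \<epsilon>'"
      then show ?thesis by (intro b) (auto simp: \<epsilon>'_def)
    next
      assume "\<epsilon>'' < \<epsilon> \<and> \<epsilon> < 1/2"
      then show ?thesis by (intro c) (auto simp: \<epsilon>''_def)
    qed
    moreover have "0 \<le> \<epsilon>" "\<epsilon> \<le> 1"
      using that by (auto simp: \<epsilon>'_def \<epsilon>''_def)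
    ultimately show ?thesis
      using assms(1,2) by (intro unique_best_protocol_first_bitI) blast+
  qed
  moreover have "0 < \<epsilon>'" "\<epsilon>' < \<epsilon>''" "\<epsilon>'' < 1/2"
    using \<open>b < 1\<close> \<open>0 < c\<close> by (auto simp: \<epsilon>'_def \<epsilon>''_def min_def max_def)
  ultimately show ?thesis by blast
qed

end
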